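(* Let $\alpha\in\mathbb Z\setminus\{0,1\}$ and let $(h_n)$ be the sequence with $h_0=0$, $h_1=1$, $h_2=-\alpha^2(\alpha-1)$, $h_3=-\alpha^6(\alpha-1)^3$, $h_4=\alpha^{11}(\alpha-1)^6$, and for $m\ge2$: $h_{2m+1}=h_{m+2}h_m^3-h_{m-1}h_{m+1}^3$, for $m\ge 3$: $h_{2m}=h_m\big(h_{m+2}h_{m-1}^2-h_{m-2}h_{m+1}^2\big)/h_2$. (i) If $n\equiv 1,13\pmod{14}$, then $h_n$ is a square. (ii) If $n\equiv 1,3,8,13,18,20\pmod{21}$, then $h_n$ is a cube.
   Context: The sequence defined is the elliptic divisibility sequence attached to the point $(0,0)$ of order $7$ on the Tate normal form curve with $b=\alpha^3-\alpha^2$, $c=\alpha^2-\alpha$; its seventh term is zero. Convention: an integer $m$ is called a square if $m=\pm\beta^2$ for some nonzero integer $\beta$, and a cube if $m=\beta^3$ for some nonzero integer $\beta$. *)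

theory Defs
  imports Complex_Main "HOL-Number_Theory.Cong"
begin

text \<open>Squares are taken up to sign, and zero counts neither as a square nor as a cube.\<close>

definition square_up_to_sign :: "int \<Rightarrow> bool" where
  "square_up_to_sign m \<longleftrightarrow> (\<exists>\<beta>::int. \<beta> \<noteq> 0 \<and> (m = \<beta>\<^sup>2 \<or> m = - (\<beta>\<^sup>2)))"

definition nonzero_cube :: "int \<Rightarrow> bool" where
  "nonzero_cube m \<longleftrightarrow> (\<exists>\<beta>::int. \<beta> \<noteq> 0 \<and> m = \<beta> ^ 3)"

end

theory Submission imports Defs begin

text \<open>
  The point has order 7, so the sequence is quasi-periodic:
  \<open>h (7 k + r) = h r * A ^ (k r) * B ^ k\<^sup>2\<close> with \<open>A = \<alpha> ^ 10 (\<alpha> - 1) ^ 6\<close> and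
  \<open>B = \<alpha> ^ 35 (\<alpha> - 1) ^ 21\<close>. Both recurrences are homogeneous under this shift, so that they need
  to be verified only for seven consecutive values of \<open>m\<close>, where they reduce to \<open>\<alpha> - (\<alpha> - 1) = 1\<close>.
  Replacing \<open>k\<close> by \<open>2 k\<close> or \<open>3 k\<close> makes the two periodicity factors squares or cubes, which leaves
  finitely many terms to inspect.
\<close>

text \<open>\<open>u\<close> and \<open>v\<close> stand for \<alpha> and \<alpha> - 1. As separate
  variables they make every term zero or, up to sign, a monomial.\<close>

definition eds7 :: "int \<Rightarrow> int \<Rightarrow> nat \<Rightarrow> int" where
  "eds7 u v n =
     [0, 1, - (u^2 * v), - (u^6 * v^3), u^11 * v^6, u^17 * v^10, - (u^25 * v^15)] ! (n mod 7)
     * (u^10 * v^6) ^ (n div 7 * (n mod 7)) * (u^35 * v^21) ^ (n div 7)\<^sup>2"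

lemma eds7_values:
  shows "eds7 u v 0 = 0"
    and "eds7 u v 1 = 1"
    and "eds7 u v 2 = - (u^2 * v)"
    and "eds7 u v 3 = - (u^6 * v^3)"
    and "eds7 u v 4 = u^11 * v^6"
    and "eds7 u v 5 = u^17 * v^10"
    and "eds7 u v 6 = - (u^25 * v^15)"
    and "eds7 u v 7 = 0"
    and "eds7 u v 8 = u^45 * v^27"
    and "eds7 u v 9 = - (u^57 * v^34)"
    and "eds7 u v 10 = - (u^71 * v^42)"
    and "eds7 u v 11 = u^86 * v^51"
    and "eds7 u v 12 = u^102 * v^61"
    and "eds7 u v 13 = - (u^120 * v^72)"
    and "eds7 u v 14 = 0"
    and "eds7 u v 15 = u^160 * v^96"
    and "eds7 u v 16 = - (u^182 * v^109)"
    and "eds7 u v 17 = - (u^206 * v^123)"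
    and "eds7 u v 18 = u^231 * v^138"
    and "eds7 u v 20 = - (u^285 * v^171)"
  by (simp_all add: eds7_def power_mult_distrib flip: power_mult) algebra+

text \<open>Here \<open>r\<close> may exceed 6, so an index such as \<open>2 * i + 1\<close> can be
  split off without being reduced mod 7.\<close>

lemma eds7_shift:
  "eds7 u v (7 * k + r) = eds7 u v r * (u^10 * v^6) ^ (k * r) * (u^35 * v^21) ^ k\<^sup>2"
proof -
  define A B where "A = u^10 * v^6" and "B = u^35 * v^21"
  define q s where "q = r div 7" and "s = r mod 7"
  have r: "r = 7 * q + s" by (simp add: q_def s_def)
  \<comment> \<open>The cross term of \<open>(k + q)\<^sup>2\<close> is absorbed because \<open>A ^ 7 = B\<^sup>2\<close>.\<close>
  have AB: "B\<^sup>2 = A ^ 7"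
    by (simp add: A_def B_def power_mult_distrib flip: power_mult)
  have "A ^ ((k + q) * s) * B ^ (k + q)\<^sup>2
      = A ^ (q * s) * B ^ q\<^sup>2 * (A ^ (k * s) * (B\<^sup>2) ^ (k * q)) * B ^ k\<^sup>2"
    by (simp add: power2_sum distrib_left distrib_right power_add ac_simps flip: power_mult)
  also have "A ^ (k * s) * (B\<^sup>2) ^ (k * q) = A ^ (k * r)"
    unfolding AB by (simp add: r distrib_left power_add ac_simps flip: power_mult)
  finally show ?thesis
    by (simp add: eds7_def A_def B_def q_def s_def ac_simps)
qed

text \<open>This is \<open>u - v = 1\<close> times a monomial, the form in which the relation enters
  the recurrences.\<close>

lemma three_term:
  fixes u v :: int
  assumes "u = v + 1"
  shows "u ^ Suc a * v ^ b = u ^ a * v ^ Suc b + u ^ a * v ^ b"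
  by (simp add: assms algebra_simps)

text \<open>Representatives 2 to 8 instead of 0 to 6 keep the differences \<open>i - 1\<close> and
  \<open>i - 2\<close> free of truncation.\<close>

lemma obtain_residue_from_2:
  fixes m :: nat
  assumes "m \<ge> 2"
  obtains k i where "m = 7 * k + i" "i \<in> {2, 3, 4, 5, 6, 7, 8}"
proof
  show "m = 7 * ((m - 2) div 7) + ((m - 2) mod 7 + 2)" using assms by simp
  have "(m - 2) mod 7 < 7" by simp
  then show "(m - 2) mod 7 + 2 \<in> {2, 3, 4, 5, 6, 7, 8}" unfolding insert_iff by linarith
qed

lemma eds7_odd:
  assumes uv: "u = v + 1" and m: "m \<ge> 2"
  shows "eds7 u v (2 * m + 1) =
    eds7 u v (m + 2) * eds7 u v m ^ 3 - eds7 u v (m - 1) * eds7 u v (m + 1) ^ 3"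
proof -
  obtain k i where mk: "m = 7 * k + i" and i: "i \<in> {2, 3, 4, 5, 6, 7, 8}"
    using obtain_residue_from_2 [OF m] .
  define A B where "A = u^10 * v^6" and "B = u^35 * v^21"
  note shift = eds7_shift [of u v, folded A_def B_def]
  \<comment> \<open>\<open>t1\<close> and \<open>t2\<close> are the instances \<open>i = 2\<close>
    and \<open>i = 4\<close>. Every other instance contains the zero term at index 7 and is an
    identity of monomials.\<close>
  have t1: "u^17 * v^10 = (u^6 * v^3)^3 - u^11 * v^6 * (u\<^sup>2 * v)^3"
    using three_term [OF uv, of 17 9, simplified] by algebra
  have t2: "- (u^57 * v^34) = u^6 * v^3 * (u^17 * v^10)^3 - u^25 * v^15 * (u^11 * v^6)^3"
    using three_term [OF uv, of 57 33, simplified] by algebra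
  have "\<forall>i\<in>{2, 3, 4, 5, 6, 7, 8}. eds7 u v (2 * i + 1) =
        eds7 u v (i + 2) * eds7 u v i ^ 3 - eds7 u v (i - 1) * eds7 u v (i + 1) ^ 3"
    by (simp add: eds7_values eds7_values(2) [simplified], intro conjI)
      (rule t1 | rule t2 | algebra)+
  note small = bspec [OF this i]
  define j where "j = i - 1"
  have j: "i = j + 1" using i by (auto simp: j_def)
  have idx: "2 * m + 1 = 7 * (2 * k) + (2 * i + 1)" "m + 2 = 7 * k + (i + 2)"
    "m - 1 = 7 * k + (i - 1)" "m + 1 = 7 * k + (i + 1)"
    using mk j by auto
  \<comment> \<open>In these variables both products on the right and the term on the left carry the
    same factor \<open>x ^ 4 * X ^ 6 * Y ^ 4\<close>.\<close>
  define x X Y where "x = A ^ (k * j)" and "X = A ^ k" and "Y = B ^ k\<^sup>2"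
  have pw: "A ^ (2 * k * (2 * i + 1)) = x ^ 4 * X ^ 6" "A ^ (k * (i + 2)) = x * X ^ 3"
    "A ^ (k * i) = x * X" "A ^ (k * (i - 1)) = x" "A ^ (k * (i + 1)) = x * X ^ 2"
    "B ^ (2 * k)\<^sup>2 = Y ^ 4" "B ^ k\<^sup>2 = Y"
    by (simp_all add: x_def X_def Y_def j algebra_simps numeral_eq_Suc flip: power_mult power_add)
  show ?thesis
    unfolding idx unfolding mk shift small pw by algebra
qed

text \<open>Multiplying through by the term at index 2 keeps the identity inside the
  integers.\<close>

lemma eds7_even:
  assumes uv: "u = v + 1" and m: "m \<ge> 2"
  shows "eds7 u v 2 * eds7 u v (2 * m) =
    eds7 u v m * (eds7 u v (m + 2) * eds7 u v (m - 1) ^ 2 - eds7 u v (m - 2) * eds7 u v (m + 1) ^ 2)"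
proof -
  obtain k i where mk: "m = 7 * k + i" and i: "i \<in> {2, 3, 4, 5, 6, 7, 8}"
    using obtain_residue_from_2 [OF m] .
  define A B where "A = u^10 * v^6" and "B = u^35 * v^21"
  note shift = eds7_shift [of u v, folded A_def B_def]
  \<comment> \<open>These are the instances \<open>i = 3\<close> and \<open>i = 4\<close>; each of
    the others contains a zero term, at index 0 or 7.\<close>
  have t1: "u\<^sup>2 * v * (u^25 * v^15) =
      - (u^6 * v^3 * (u^17 * v^10 * (u\<^sup>2 * v)\<^sup>2 - (u^11 * v^6)\<^sup>2))"
    using three_term [OF uv, of 27 15, simplified] by algebra
  have t2: "- (u\<^sup>2 * v * (u^45 * v^27)) =
      u^11 * v^6 * (u\<^sup>2 * v * (u^17 * v^10)\<^sup>2 - u^25 * v^15 * (u^6 * v^3)\<^sup>2)"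
    using three_term [OF uv, of 47 27, simplified] by algebra
  have "\<forall>i\<in>{2, 3, 4, 5, 6, 7, 8}. eds7 u v 2 * eds7 u v (2 * i) =
        eds7 u v i * (eds7 u v (i + 2) * eds7 u v (i - 1) ^ 2 - eds7 u v (i - 2) * eds7 u v (i + 1) ^ 2)"
    by (simp add: eds7_values eds7_values(2) [simplified], intro conjI)
      (rule t1 | rule t2 | algebra)+
  note small = bspec [OF this i]
  define j where "j = i - 2"
  have j: "i = j + 2" using i by (auto simp: j_def)
  have idx: "2 * m = 7 * (2 * k) + 2 * i" "m + 2 = 7 * k + (i + 2)"
    "m - 1 = 7 * k + (i - 1)" "m - 2 = 7 * k + (i - 2)" "m + 1 = 7 * k + (i + 1)"
    using mk j by auto
  define x X Y where "x = A ^ (k * j)" and "X = A ^ k" and "Y = B ^ k\<^sup>2"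
  have pw: "A ^ (2 * k * (2 * i)) = x ^ 4 * X ^ 8" "A ^ (k * (i + 2)) = x * X ^ 4"
    "A ^ (k * i) = x * X ^ 2" "A ^ (k * (i - 1)) = x * X" "A ^ (k * (i - 2)) = x"
    "A ^ (k * (i + 1)) = x * X ^ 3" "B ^ (2 * k)\<^sup>2 = Y ^ 4" "B ^ k\<^sup>2 = Y"
    by (simp_all add: x_def X_def Y_def j algebra_simps numeral_eq_Suc flip: power_mult power_add)
  have "eds7 u v 2 * eds7 u v (2 * m) = eds7 u v 2 * eds7 u v (2 * i) * (x ^ 4 * X ^ 8 * Y ^ 4)"
    unfolding idx(1) shift pw by (simp only: mult.assoc)
  then show ?thesis
    unfolding idx(2-) small unfolding mk shift pw by algebra
qed

text \<open>For \<open>n > 4\<close> the recurrences involve only indices up to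
  \<open>m + 2 < n\<close>, so strong induction applies. Rational values accommodate the division by
  \<open>h 2\<close>; integrality is a consequence.\<close>

lemma eds7_unique:
  fixes h :: "nat \<Rightarrow> rat"
  assumes uv: "u = v + 1" and "u \<noteq> 0" "v \<noteq> 0"
    and init: "\<And>n. n \<le> 4 \<Longrightarrow> h n = of_int (eds7 u v n)"
    and odd: "\<And>m. m \<ge> 2 \<Longrightarrow> h (2 * m + 1) = h (m + 2) * (h m)^3 - h (m - 1) * (h (m + 1))^3"
    and even: "\<And>m. m \<ge> 3 \<Longrightarrow>
      h (2 * m) = h m * (h (m + 2) * (h (m - 1))^2 - h (m - 2) * (h (m + 1))^2) / h 2"
  shows "h n = of_int (eds7 u v n)"
proof (induction n rule: less_induct)
  case (less n)
  show ?case
  proof (cases "n \<le> 4")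
    case True
    then show ?thesis by (rule init)
  next
    case False
    show ?thesis
    proof (cases "Parity.even n")
      case True
      then obtain m where n: "n = 2 * m" by (elim evenE)
      have m: "m \<ge> 3" "m \<ge> 2" using False n by auto
      have IH: "h i = of_int (eds7 u v i)" if "i \<le> m + 2" for i
        using that m n by (intro less.IH) auto
      have h2: "h 2 \<noteq> 0" using init [of 2] assms(2,3) by (simp add: eds7_values)
      have "h 2 * of_int (eds7 u v n) = of_int (eds7 u v 2 * eds7 u v (2 * m))"
        by (simp add: init n)
      also have "\<dots> = h m * (h (m + 2) * (h (m - 1))^2 - h (m - 2) * (h (m + 1))^2)"
        unfolding eds7_even [OF uv m(2)] by (simp add: IH)
      also have "\<dots> = h 2 * h n" using even [OF m(1)] h2 n by simp
      finally show ?thesis using h2 by simp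
    next
      case odd_n: False
      then obtain m where n: "n = 2 * m + 1" by (elim oddE)
      have m: "m \<ge> 2" using False n by auto
      have IH: "h i = of_int (eds7 u v i)" if "i \<le> m + 2" for i
        using that m n by (intro less.IH) auto
      show ?thesis
        unfolding n odd [OF m] eds7_odd [OF uv m] by (simp add: IH)
    qed
  qed
qed

lemma eds7_shift_power:
  obtains w where "eds7 u v (7 * p * j + r) = eds7 u v r * w ^ p" "u \<noteq> 0 \<Longrightarrow> v \<noteq> 0 \<Longrightarrow> w \<noteq> 0"
proof
  \<comment> \<open>For \<open>k = p * j\<close> the exponents \<open>k * r\<close> and
    \<open>k\<^sup>2\<close> are \<open>p\<close> times \<open>j * r\<close> and
    \<open>p * j\<^sup>2\<close>.\<close>
  let ?w = "(u^10 * v^6) ^ (j * r) * (u^35 * v^21) ^ (p * j\<^sup>2)"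
  show "eds7 u v (7 * p * j + r) = eds7 u v r * ?w ^ p"
    using eds7_shift [of u v "p * j" r]
    by (simp add: power_mult_distrib power2_eq_square ac_simps flip: power_mult)
  show "?w \<noteq> 0" if "u \<noteq> 0" "v \<noteq> 0" using that by simp
qed

lemma nat_cong_less_obtain:
  fixes n r M :: nat
  assumes "[n = r] (mod M)" "r < M"
  obtains j where "n = M * j + r"
proof
  show "n = M * (n div M) + r"
    using assms by (metis cong_def mod_less mult_div_mod_eq)
qed

lemma eds7_square:
  assumes "u \<noteq> 0" "v \<noteq> 0" "[n = r] (mod 14)" "r \<in> {1, 13}"
  shows "square_up_to_sign (eds7 u v n)"
proof -
  have "r < 14" using assms(4) by auto
  with assms(3) obtain j where "n = 14 * j + r" by (rule nat_cong_less_obtain)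
  then obtain w where w: "eds7 u v n = eds7 u v r * w\<^sup>2" "w \<noteq> 0"
    using eds7_shift_power [of u v 2 j r] assms(1,2) by auto
  have "\<exists>b. b \<noteq> 0 \<and> (eds7 u v r = b\<^sup>2 \<or> eds7 u v r = - b\<^sup>2)"
    using assms(4)
  proof (elim insertE emptyE)
    assume "r = 1"
    then show ?thesis by (intro exI [of _ 1]) (simp add: eds7_values(2) [simplified])
  next
    assume "r = 13"
    then show ?thesis using assms(1,2)
      \<comment> \<open>The term at 13 is \<open>- (u^120 * v^72)\<close>; its sign is allowed by
        the convention on squares.\<close>
      by (intro exI [of _ "u^60 * v^36"]) (simp add: eds7_values power_mult_distrib)
  qed
  then obtain b where "b \<noteq> 0" "eds7 u v r = b\<^sup>2 \<or> eds7 u v r = - b\<^sup>2" by blast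
  with w show ?thesis unfolding square_up_to_sign_def
    by (intro exI [of _ "b * w"]) (auto simp: power_mult_distrib)
qed

lemma eds7_cube:
  assumes "u \<noteq> 0" "v \<noteq> 0" "[n = r] (mod 21)" "r \<in> {1, 3, 8, 13, 18, 20}"
  shows "nonzero_cube (eds7 u v n)"
proof -
  have "r < 21" using assms(4) by auto
  with assms(3) obtain j where "n = 21 * j + r" by (rule nat_cong_less_obtain)
  then obtain w where w: "eds7 u v n = eds7 u v r * w ^ 3" "w \<noteq> 0"
    using eds7_shift_power [of u v 3 j r] assms(1,2) by auto
  \<comment> \<open>At these residues both exponents are divisible by 3, and a minus sign is itself
    a cube.\<close>
  have vals: "eds7 u v 1 = 1 ^ 3" "eds7 u v 3 = (- (u^2 * v)) ^ 3"
    "eds7 u v 8 = (u^15 * v^9) ^ 3" "eds7 u v 13 = (- (u^40 * v^24)) ^ 3"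
    "eds7 u v 18 = (u^77 * v^46) ^ 3" "eds7 u v 20 = (- (u^95 * v^57)) ^ 3"
    unfolding eds7_values by (simp_all add: power_mult_distrib)
  obtain b where b: "eds7 u v r = b ^ 3" using assms(4) vals by (elim insertE emptyE) blast+
  \<comment> \<open>No admissible residue is a multiple of 7, so the value is a nonzero monomial up
    to sign.\<close>
  have "eds7 u v r \<noteq> 0"
    using assms(1,2,4) by (auto simp: eds7_values eds7_values(2) [simplified])
  with b have "b \<noteq> 0" by auto
  with w b show ?thesis unfolding nonzero_cube_def
    by (intro exI [of _ "b * w"]) (simp add: power_mult_distrib)
qed

theorem theorem5p8:
  fixes \<alpha> :: int and h :: "nat \<Rightarrow> rat"
  assumes "\<alpha> \<notin> {0, 1}"
    and "h 0 = 0"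
    and "h 1 = 1"
    and "h 2 = of_int (- (\<alpha>^2 * (\<alpha> - 1)))"
    and "h 3 = of_int (- (\<alpha>^6 * (\<alpha> - 1)^3))"
    and "h 4 = of_int (\<alpha>^11 * (\<alpha> - 1)^6)"
    and "\<And>m. m \<ge> 2 \<Longrightarrow>
           h (2 * m + 1) = h (m + 2) * (h m)^3 - h (m - 1) * (h (m + 1))^3"
    and "\<And>m. m \<ge> 3 \<Longrightarrow>
           h (2 * m) = h m * (h (m + 2) * (h (m - 1))^2 - h (m - 2) * (h (m + 1))^2) / h 2"
  shows "(\<forall>n. [n = 1] (mod 14) \<or> [n = 13] (mod 14) \<longrightarrow>
            (\<exists>k::int. h n = of_int k \<and> square_up_to_sign k))
       \<and> (\<forall>n. [n = 1] (mod 21) \<or> [n = 3] (mod 21) \<or> [n = 8] (mod 21) \<or>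
               [n = 13] (mod 21) \<or> [n = 18] (mod 21) \<or> [n = 20] (mod 21) \<longrightarrow>
            (\<exists>k::int. h n = of_int k \<and> nonzero_cube k))"
proof -
  have nz: "\<alpha> \<noteq> 0" "\<alpha> - 1 \<noteq> 0" using assms(1) by auto
  have init: "h n = of_int (eds7 \<alpha> (\<alpha> - 1) n)" if "n \<le> 4" for n
  proof -
    have "n \<in> {0, 1, 2, 3, 4}" using that by auto
    then show ?thesis
      using assms(2-6) by (elim insertE emptyE) (simp_all only: eds7_values of_int_0 of_int_1)
  qed
  \<comment> \<open>The premise discharged by simplification is \<open>u = v + 1\<close> for
    \<open>u = \<alpha>\<close> and \<open>v = \<alpha> - 1\<close>.\<close>
  have "h n = of_int (eds7 \<alpha> (\<alpha> - 1) n)" for n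
    by (rule eds7_unique [OF _ nz init assms(7,8)]) simp_all
  then show ?thesis
    using eds7_square [OF nz] eds7_cube [OF nz] by blast
qed

end
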